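(* Every non-trivial congruence $\mathfrak{C}$ on the extended bicyclic semigroup $\mathscr{C}_{\mathbb{Z}}$ is a group congruence, and moreover the quotient semigroup $\mathscr{C}_{\mathbb{Z}}/\mathfrak{C}$ is isomorphic to a cyclic group.
   Context: The extended bicyclic semigroup $\mathscr{C}_{\mathbb{Z}}$ is the set $\mathbb{Z}\times\mathbb{Z}$ with the operation $(a,b)\cdot(c,d)=(a-b+c,d)$ if $b<c$; $(a,b)\cdot(c,d)=(a,d)$ if $b=c$; $(a,b)\cdot(c,d)=(a,d+b-c)$ if $b>c$. A congruence on a semigroup $S$ is non-trivial if it is distinct from the universal congruence and from the identity congruence on $S$. A congruence $\mathfrak{C}$ on $S$ is a group congruence if $S/\mathfrak{C}$ is a group. *)

theory Defs
  imports "HOL-Algebra.Elementary_Groups"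
begin

text \<open>The extended bicyclic semigroup is the whole type \<open>int \<times> int\<close> with the
  operation below.  Accordingly, a semigroup here is a binary operation on a whole type.\<close>

fun ext_bicyclic_mult :: "int \<times> int \<Rightarrow> int \<times> int \<Rightarrow> int \<times> int" where
  "ext_bicyclic_mult (a, b) (c, d) =
     (if b < c then (a - b + c, d)
      else if b = c then (a, d)
      else (a, d + b - c))"

lemma semigroup_ext_bicyclic_mult: "semigroup ext_bicyclic_mult"
proof
  fix x y z :: "int \<times> int"
  show "ext_bicyclic_mult (ext_bicyclic_mult x y) z = ext_bicyclic_mult x (ext_bicyclic_mult y z)"
    by (cases x; cases y; cases z) auto
qed

definition semigroup_congruence :: "('a \<Rightarrow> 'a \<Rightarrow> 'a) \<Rightarrow> ('a \<times> 'a) set \<Rightarrow> bool" where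
  "semigroup_congruence f r \<longleftrightarrow>
     equiv UNIV r \<and>
     (\<forall>x x' y y'. (x, x') \<in> r \<longrightarrow> (y, y') \<in> r \<longrightarrow> (f x y, f x' y') \<in> r)"

text \<open>\<open>UNIV\<close> is the universal congruence and \<open>Id\<close> the identity congruence.\<close>

definition nontrivial_congruence :: "('a \<Rightarrow> 'a \<Rightarrow> 'a) \<Rightarrow> ('a \<times> 'a) set \<Rightarrow> bool" where
  "nontrivial_congruence f r \<longleftrightarrow> semigroup_congruence f r \<and> r \<noteq> UNIV \<and> r \<noteq> Id"

definition quotient_mult :: "('a \<Rightarrow> 'a \<Rightarrow> 'a) \<Rightarrow> ('a \<times> 'a) set \<Rightarrow> 'a set \<Rightarrow> 'a set \<Rightarrow> 'a set" where
  "quotient_mult f r X Y = (\<Union>x\<in>X. \<Union>y\<in>Y. r `` {f x y})"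

lemma quotient_mult_class:
  assumes "semigroup_congruence f r"
  shows "quotient_mult f r (r `` {x}) (r `` {y}) = r `` {f x y}"
proof -
  have eq: "equiv UNIV r" and "(\<lambda>x y. r `` {f x y}) respects2 r"
    using assms equiv_class_eq unfolding semigroup_congruence_def congruent2_def by fast+
  then show ?thesis
    unfolding quotient_mult_def by (simp add: UN_equiv_class2[OF eq eq])
qed

text \<open>A quotient semigroup carries no distinguished unit, whereas the record \<^typ>\<open>'a monoid\<close>
  has a field for one.  The candidate \<open>e\<close> is therefore a parameter; a quotient semigroup
  is a group iff some choice of \<open>e\<close> yields a group, and then \<open>e\<close> is unique.\<close>

definition quotient_semigroup :: "('a \<Rightarrow> 'a \<Rightarrow> 'a) \<Rightarrow> ('a \<times> 'a) set \<Rightarrow> 'a set \<Rightarrow> 'a set monoid" where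
  "quotient_semigroup f r e = \<lparr>carrier = UNIV // r, mult = quotient_mult f r, one = e\<rparr>"

definition group_congruence :: "('a \<Rightarrow> 'a \<Rightarrow> 'a) \<Rightarrow> ('a \<times> 'a) set \<Rightarrow> bool" where
  "group_congruence f r \<longleftrightarrow>
     semigroup_congruence f r \<and> (\<exists>e. group (quotient_semigroup f r e))"

end

theory Submission
  imports Defs "HOL-Algebra.Multiplicative_Group"
begin

text \<open>A congruence other than the identity identifies two distinct idempotents \<open>(p, p)\<close> and
  \<open>(p + n, p + n)\<close> with \<open>n > 0\<close>.  Translating this by \<open>x - p\<close> relates \<open>(x, x)\<close> to
  \<open>(x + n, x + n)\<close> for every \<open>x\<close>, and as the idempotents form a chain, \<open>(x + 1, x + 1)\<close> is caught
  in between.  Hence all idempotents are congruent, so \<open>(a, b)\<close> is congruent to \<open>(a - b, 0)\<close>, and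
  \<open>k \<mapsto> [(k, 0)]\<close> is a homomorphism of the additive group of integers onto the quotient.\<close>

text \<open>Exponentiation of a generator gives the isomorphism. Infinite order needs no separate
  case: then \<open>ord x\<close> is 0, \<open>i mod 0\<close> is \<open>i\<close>, and
  \<open>integer_mod_group 0\<close> is the group of integers.\<close>

lemma (in group) cyclic_group_imp_iso_integer_mod_group:
  assumes "cyclic_group G"
  shows "\<exists>n. G \<cong> integer_mod_group n"
proof -
  obtain x where x: "x \<in> carrier G" and G: "carrier G = range (\<lambda>n::int. x [^] n)"
    using assms cyclic_group by blast
  let ?n = "ord x"
  have eq: "x [^] (i::int) = x [^] j \<longleftrightarrow> i mod int ?n = j mod int ?n" for i j
    using x by (auto simp: int_pow_eq mod_eq_dvd_iff dvd_diff_commute)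
  have "(\<lambda>i::int. x [^] i) \<in> iso (integer_mod_group ?n) G"
  proof (rule isoI)
    have "x [^] ((i + j) mod int ?n) = x [^] i \<otimes> x [^] j" for i j :: int
      using x eq[of "(i + j) mod int ?n" "i + j"] by (simp add: int_pow_mult)
    then show "(\<lambda>i::int. x [^] i) \<in> hom (integer_mod_group ?n) G"
      using x by (auto intro: homI)
    have "y \<in> (\<lambda>i::int. x [^] i) ` carrier (integer_mod_group ?n)" if "y \<in> carrier G" for y
    proof -
      obtain i :: int where "y = x [^] i"
        using \<open>y \<in> carrier G\<close> G by blast
      then have "y = x [^] (i mod int ?n)"
        by (simp add: eq)
      moreover have "i mod int ?n \<in> carrier (integer_mod_group ?n)"
        by (simp add: carrier_integer_mod_group)
      ultimately show ?thesis
        by blast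
    qed
    then show "bij_betw (\<lambda>i::int. x [^] i) (carrier (integer_mod_group ?n)) (carrier G)"
      using x by (auto simp: bij_betw_def inj_on_def eq carrier_integer_mod_group split: if_splits)
  qed
  then have "G \<cong> integer_mod_group ?n"
    by (meson is_isoI group.iso_sym group_integer_mod_group)
  then show ?thesis ..
qed

text \<open>With the case distinction absorbed into \<open>max\<close>, products in the proofs below
  reduce to linear arithmetic.\<close>

lemma ext_bicyclic_mult_max:
  "ext_bicyclic_mult (a, b) (c, d) = (a - b + max b c, d - c + max b c)"
  by auto

declare ext_bicyclic_mult.simps [simp del]

locale ext_bicyclic_congruence =
  fixes C :: "((int \<times> int) \<times> (int \<times> int)) set"
  assumes congruence: "semigroup_congruence ext_bicyclic_mult C"
begin

abbreviation cong_rel :: "int \<times> int \<Rightarrow> int \<times> int \<Rightarrow> bool" (infix "\<approx>" 50)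
  where "x \<approx> y \<equiv> (x, y) \<in> C"

abbreviation bicyclic_mult :: "int \<times> int \<Rightarrow> int \<times> int \<Rightarrow> int \<times> int" (infixl "\<star>" 70)
  where "x \<star> y \<equiv> ext_bicyclic_mult x y"

lemma equiv: "equiv UNIV C"
  using congruence by (simp add: semigroup_congruence_def)

lemma rel_refl: "x \<approx> x"
  using equiv by (meson equiv_def refl_onD UNIV_I)

lemma rel_sym: "x \<approx> y \<Longrightarrow> y \<approx> x"
  using equiv by (meson equiv_def symD)

lemma rel_trans [trans]: "x \<approx> y \<Longrightarrow> y \<approx> z \<Longrightarrow> x \<approx> z"
  using equiv by (meson equiv_def transD)

lemma rel_mult: "x \<approx> x' \<Longrightarrow> y \<approx> y' \<Longrightarrow> x \<star> y \<approx> x' \<star> y'"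
  using congruence unfolding semigroup_congruence_def by blast

lemma rel_left: "y \<approx> y' \<Longrightarrow> x \<star> y \<approx> x \<star> y'"
  by (simp add: rel_mult rel_refl)

lemma rel_right: "x \<approx> x' \<Longrightarrow> x \<star> y \<approx> x' \<star> y"
  by (simp add: rel_mult rel_refl)

text \<open>Right multiplication by \<open>(b, a)\<close>, the inverse of \<open>(a, b)\<close>,
  turns both sides into idempotents.\<close>

lemma idempotents_if_same_difference:
  assumes "(a, b) \<approx> (a + n, b + n)" "n > 0"
  shows "(a, a) \<approx> (a + n, a + n)"
  using rel_right[OF assms(1), of "(b, a)"] assms(2) by (simp add: ext_bicyclic_mult_max)

text \<open>After cancelling \<open>a\<close>, the element \<open>(p, p + n)\<close> is congruent to
  \<open>(p, p)\<close>, and hence so is its inverse \<open>(p + n, p)\<close>. The inverse times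
  the element is \<open>(p + n, p + n)\<close>.\<close>

lemma idempotents_if_same_left:
  assumes "(a, p) \<approx> (a, p + n)" "n > 0"
  shows "(p, p) \<approx> (p + n, p + n)"
proof -
  have g: "(p, p) \<approx> (p, p + n)"
    using rel_left[OF assms(1), of "(p, a)"] by (simp add: ext_bicyclic_mult_max)
  from rel_right[OF g, of "(p + n, p)"] have g': "(p + n, p) \<approx> (p, p)"
    using assms(2) by (simp add: ext_bicyclic_mult_max)
  from rel_mult[OF g' rel_sym[OF g]] have "(p + n, p + n) \<approx> (p, p)"
    using assms(2) by (simp add: ext_bicyclic_mult_max add.commute)
  then show ?thesis
    by (rule rel_sym)
qed

lemma distinct_idempotents:
  assumes "C \<noteq> Id"
  shows "\<exists>p n. n > 0 \<and> (p, p) \<approx> (p + n, p + n)"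
proof -
  obtain a b c d where rel: "(a, b) \<approx> (c, d)" and ne: "(a, b) \<noteq> (c, d)"
    using assms rel_refl by (auto simp: set_eq_iff)
  show ?thesis
  proof (cases "a - b = c - d")
    case True
    have wlog: ?thesis if "(a, b) \<approx> (c, d)" "a - b = c - d" "a < c" for a b c d
    proof (intro exI conjI)
      have d: "b + (c - a) = d"
        using \<open>a - b = c - d\<close> by simp
      show "(a, a) \<approx> (a + (c - a), a + (c - a))"
        using idempotents_if_same_difference[of a b "c - a"] that(1,3) by (simp add: d)
    qed (use \<open>a < c\<close> in simp)
    have "a < c \<or> c < a"
      using ne True by auto
    then show ?thesis
      using wlog[OF rel True] wlog[OF rel_sym[OF rel] True[symmetric]] by blast
  next
    case False
    have wlog: ?thesis if "(0, p) \<approx> (0, q)" "p < q" for p q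
    proof (intro exI conjI)
      show "(p, p) \<approx> (p + (q - p), p + (q - p))"
        using idempotents_if_same_left[of 0 p "q - p"] that by simp
    qed (use \<open>p < q\<close> in simp)
    \<comment> \<open>Left multiplication by \<open>(0, max a c)\<close> moves both first
      coordinates to 0 and preserves the differences of coordinates, so the second coordinates stay
      distinct.\<close>
    let ?p = "b - a + max a c" and ?q = "d - c + max a c"
    have pq: "(0, ?p) \<approx> (0, ?q)"
      using rel_left[OF rel, of "(0, max a c)"] by (simp add: ext_bicyclic_mult_max)
    have "?p < ?q \<or> ?q < ?p"
      using False by linarith
    then show ?thesis
      using wlog[OF pq] wlog[OF rel_sym[OF pq]] by blast
  qed
qed

lemma rel_shift:
  assumes "C \<noteq> Id"
  shows "(a, b) \<approx> (a + 1, b + 1)"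
proof -
  obtain p n where n: "n > 0" and p: "(p, p) \<approx> (p + n, p + n)"
    using assms distinct_idempotents by blast
  \<comment> \<open>Sandwiching between \<open>(a, p)\<close> and its inverse \<open>(p, a)\<close>
    translates these idempotents by \<open>a - p\<close>.\<close>
  have idem: "(a, a) \<approx> (a + n, a + n)"
    using rel_right[OF rel_left[OF p, of "(a, p)"], of "(p, a)"] n
    by (simp add: ext_bicyclic_mult_max)
  \<comment> \<open>A product of two idempotents is the one with the larger coordinate, and
    \<open>n\<close> is at least 1.\<close>
  have "(a + 1, a + 1) \<approx> (a + n, a + n)"
    using rel_right[OF idem, of "(a + 1, a + 1)"] n by (simp add: ext_bicyclic_mult_max)
  with idem have "(a, a) \<approx> (a + 1, a + 1)"
    using rel_sym rel_trans by blast
  from rel_right[OF this, of "(a, b)"] show ?thesis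
    by (simp add: ext_bicyclic_mult_max algebra_simps)
qed

lemma rel_difference:
  assumes "C \<noteq> Id"
  shows "(a, b) \<approx> (a - b, 0)"
proof -
  have *: "(k, 0) \<approx> (k + int m, int m)" for k m
  proof (induction m)
    case 0
    show ?case by (simp add: rel_refl)
  next
    case (Suc m)
    then show ?case
      using rel_trans rel_shift[OF assms, of "k + int m" "int m"] by (simp add: algebra_simps)
  qed
  have **: "(k - int m, - int m) \<approx> (k, 0)" for k m
  proof (induction m)
    case 0
    show ?case by (simp add: rel_refl)
  next
    case (Suc m)
    then show ?case
      using rel_trans rel_shift[OF assms, of "k - int (Suc m)" "- int (Suc m)"] by simp
  qed
  show ?thesis
  proof (cases "b \<ge> 0")
    case True
    then show ?thesis using rel_sym[OF *[of "a - b" "nat b"]] by simp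
  next
    case False
    then show ?thesis using **[of "a - b" "nat (- b)"] by simp
  qed
qed

definition quotient_map :: "int \<Rightarrow> (int \<times> int) set"
  where "quotient_map k = C `` {(k, 0)}"

abbreviation quotient :: "(int \<times> int) set monoid"
  where "quotient \<equiv> quotient_semigroup ext_bicyclic_mult C (quotient_map 0)"

lemma quotient_map_epi:
  assumes "C \<noteq> Id"
  shows "quotient_map \<in> epi integer_group quotient"
proof -
  \<comment> \<open>A class depends only on the difference of coordinates, which is additive under
    the product; this gives both the homomorphism law and surjectivity.\<close>
  have cls: "C `` {(a, b)} = quotient_map (a - b)" for a b
    unfolding quotient_map_def using equiv_class_eq[OF equiv rel_difference[OF assms]] .
  have "quotient_mult ext_bicyclic_mult C (quotient_map k) (quotient_map l) = quotient_map (k + l)"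
    for k l
  proof -
    have "quotient_mult ext_bicyclic_mult C (quotient_map k) (quotient_map l) =
        C `` {(k + max 0 l, 0 - l + max 0 l)}"
      unfolding quotient_map_def quotient_mult_class[OF congruence] ext_bicyclic_mult_max by simp
    then show ?thesis
      unfolding cls by simp
  qed
  moreover have "UNIV // C = range quotient_map"
  proof
    show "UNIV // C \<subseteq> range quotient_map"
      using cls by (auto elim!: quotientE)
    show "range quotient_map \<subseteq> UNIV // C"
      by (auto simp: quotient_map_def intro: quotientI)
  qed
  ultimately show ?thesis
    by (simp add: epi_def hom_def quotient_semigroup_def Pi_def)
qed

text \<open>\<open>hom\<close> demands no group structure of its target, so the group axioms pass
  from the integers to the image, which is the whole quotient.\<close>

lemma group_quotient:
  assumes "C \<noteq> Id"
  shows "group quotient"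
proof -
  have epi: "quotient_map \<in> hom integer_group quotient" "range quotient_map = carrier quotient"
    using quotient_map_epi[OF assms] by (auto simp: epi_def)
  have "group (quotient\<lparr>carrier := range quotient_map, one := quotient_map 0\<rparr>)"
    using group.hom_imp_img_group[OF group_integer_group epi(1)] by simp
  then show ?thesis
    unfolding epi(2) by (simp add: quotient_semigroup_def)
qed

end

theorem proposition2p2:
  fixes C :: "((int \<times> int) \<times> (int \<times> int)) set"
  assumes "nontrivial_congruence ext_bicyclic_mult C"
  shows "group_congruence ext_bicyclic_mult C \<and>
    (\<exists>e (G :: int monoid).
       group (quotient_semigroup ext_bicyclic_mult C e) \<and>
       group G \<and> cyclic_group G \<and>
       quotient_semigroup ext_bicyclic_mult C e \<cong> G)"
proof -
  interpret ext_bicyclic_congruence C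
    using assms by unfold_locales (simp add: nontrivial_congruence_def)
  have "C \<noteq> Id"
    using assms by (simp add: nontrivial_congruence_def)
  note group = group_quotient[OF this]
  have cyclic: "cyclic_group quotient"
    using group.cyclic_group_epimorphic_image[OF group_integer_group] quotient_map_epi \<open>C \<noteq> Id\<close> group
    by fastforce
  \<comment> \<open>The cyclic group \<open>G\<close> must live on the type \<open>int\<close>, so
    the quotient is replaced by a concrete group of integers.\<close>
  obtain n where iso: "quotient \<cong> integer_mod_group n"
    using group.cyclic_group_imp_iso_integer_mod_group[OF group cyclic] by blast
  then have "cyclic_group (integer_mod_group n)"
    using isomorphic_group_cyclicity[OF iso group group_integer_mod_group] cyclic by simp
  then show ?thesis
    using group congruence iso group_integer_mod_group
    unfolding group_congruence_def by blast
qed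

end
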